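(* For positive integers $n$ (as $n\to\infty$), there exists a family of digraphs, each with at most $n$ vertices, such that the core of the tensor product of the family has $\Omega\left(n^{\frac{2^{\sqrt n}}{\sqrt n}}\right)$ vertices.
   Context: All digraphs are finite, without loops and parallel arcs; digons (pairs of opposite arcs) are allowed. A homomorphism is a vertex map sending arcs to arcs. The tensor product of a finite family of digraphs has as vertex set the Cartesian product, with an arc from $(u_i)_i$ to $(v_i)_i$ iff $u_i\to v_i$ is an arc in every coordinate. The core of a digraph $G$ is the digraph with the fewest vertices that is homomorphically equivalent to $G$ (homomorphisms exist in both directions); it is unique up to isomorphism. The order of a digraph is its number of vertices. *)

theory Defs
  imports Complex_Main "HOL-Library.FuncSet" "HOL-Library.Landau_Symbols"
    "Graph_Theory.Pair_Digraph"
begin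

text \<open>
  Digraphs are the \<^locale>\<open>pair_digraph\<close>s: finite, no loops, arcs given as a
  set of ordered pairs (so no parallel arcs, but digons are allowed).
\<close>

definition digraph_hom ::
    "'a pair_pre_digraph \<Rightarrow> 'b pair_pre_digraph \<Rightarrow> ('a \<Rightarrow> 'b) \<Rightarrow> bool" where
  "digraph_hom G H f \<longleftrightarrow>
     (\<forall>v\<in>pverts G. f v \<in> pverts H) \<and> (\<forall>(u, v)\<in>parcs G. (f u, f v) \<in> parcs H)"

definition hom_equivalent :: "'a pair_pre_digraph \<Rightarrow> 'b pair_pre_digraph \<Rightarrow> bool" where
  "hom_equivalent G H \<longleftrightarrow> (\<exists>f. digraph_hom G H f) \<and> (\<exists>g. digraph_hom H G g)"

definition tensor_product ::
    "'i set \<Rightarrow> ('i \<Rightarrow> 'a pair_pre_digraph) \<Rightarrow> ('i \<Rightarrow> 'a) pair_pre_digraph" where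
  "tensor_product I G =
     \<lparr> pverts = (\<Pi>\<^sub>E i\<in>I. pverts (G i)),
       parcs = {(u, v). u \<in> (\<Pi>\<^sub>E i\<in>I. pverts (G i)) \<and> v \<in> (\<Pi>\<^sub>E i\<in>I. pverts (G i)) \<and>
                        (\<forall>i\<in>I. (u i, v i) \<in> parcs (G i))} \<rparr>"

text \<open>
  Cores are taken with vertices in \<^typ>\<open>nat\<close> whatever the vertex type of the digraph;
  every finite digraph has an isomorphic copy there, so minimality over \<^typ>\<open>nat\<close>
  is minimality over all digraphs.
\<close>

definition is_core :: "nat pair_pre_digraph \<Rightarrow> 'a pair_pre_digraph \<Rightarrow> bool" where
  "is_core C G \<longleftrightarrow>
     pair_digraph C \<and> hom_equivalent C G \<and>
     (\<forall>H :: nat pair_pre_digraph. pair_digraph H \<and> hom_equivalent H G \<longrightarrow>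
        card (pverts C) \<le> card (pverts H))"

lemma is_core_order_unique:
  "is_core C G \<Longrightarrow> is_core C' G \<Longrightarrow> card (pverts C) = card (pverts C')"
  unfolding is_core_def by (meson le_antisym)

lemma is_core_exists:
  assumes "pair_digraph G"
  shows "\<exists>C. is_core C G"
proof -
  interpret pair_digraph G by fact
  obtain f :: "'a \<Rightarrow> nat" where f: "inj_on f (pverts G)"
    using finite_imp_inj_to_nat_seg[OF pair_finite_verts] by blast
  define H where "H = \<lparr> pverts = f ` pverts G, parcs = map_prod f f ` parcs G \<rparr>"
  have "pair_digraph H"
    using pair_finite_verts pair_finite_arcs pair_no_loops
    by unfold_locales
      (auto simp: H_def in_arcsD1 in_arcsD2 inj_on_eq_iff[OF f])
  moreover have "digraph_hom G H f"
    by (force simp: digraph_hom_def H_def)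
  moreover have "digraph_hom H G (the_inv_into (pverts G) f)"
    by (auto simp: digraph_hom_def H_def the_inv_into_f_f[OF f] in_arcsD1 in_arcsD2)
  ultimately have "pair_digraph H \<and> hom_equivalent H G"
    by (auto simp: hom_equivalent_def)
  from ex_has_least_nat[of "\<lambda>H. pair_digraph H \<and> hom_equivalent H G" H "\<lambda>H. card (pverts H)", OF this]
  show ?thesis
    unfolding is_core_def by blast
qed

lemma pair_digraph_tensor_product:
  assumes "finite I" "I \<noteq> {}" "\<And>i. i \<in> I \<Longrightarrow> pair_digraph (G i)"
  shows "pair_digraph (tensor_product I G)"
proof -
  let ?V = "\<Pi>\<^sub>E i\<in>I. pverts (G i)"
  have fin: "finite ?V"
    using assms by (intro finite_PiE) (auto simp: pair_digraph_def pair_fin_digraph_def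
        pair_fin_digraph_axioms_def)
  have "parcs (tensor_product I G) \<subseteq> ?V \<times> ?V"
    by (auto simp: tensor_product_def)
  then have fin': "finite (parcs (tensor_product I G))"
    using fin by (meson finite_SigmaI finite_subset)
  have "u \<noteq> v" if "(u, v) \<in> parcs (tensor_product I G)" for u v
  proof -
    obtain i where i: "i \<in> I" using assms(2) by blast
    interpret pair_digraph "G i" using assms(3)[OF i] .
    show ?thesis
      using that i pair_no_loops[of "(u i, v i)"] by (auto simp: tensor_product_def)
  qed
  then show ?thesis
    using fin fin' by unfold_locales (auto simp: tensor_product_def)
qed

end

theory Submission
  imports Defs "HOL-Library.Nat_Bijection" "HOL-Real_Asymp.Real_Asymp"
begin

text \<open>
  For a set \<open>S\<close> of numbers below \<open>m\<close>, let \<open>G\<^sub>S\<close> contain a directed path \<open>0 \<rightarrow> \<dots> \<rightarrow> m + 3\<close>,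
  called the spine, whose vertices from \<open>2\<close> on serve as marks, and two vertices
  \<open>top_vertex b\<close>, one for each Boolean \<open>b\<close>. Call the marks \<open>4 + i\<close> with \<open>i \<in> S\<close> together with
  \<open>2\<close> (for \<open>b = False\<close>) or \<open>3\<close> (for \<open>b = True\<close>) the pattern \<open>(S, b)\<close>. The out-neighbours
  of the top vertices are such that \<open>top_vertex b\<close> has an out-neighbour dominating the pattern
  \<open>(T, c)\<close> for every \<open>T\<close> that does not include \<open>S\<close>, while for \<open>T = S\<close> this holds only if
  \<open>b = c\<close>: \<open>mid_vertex b\<close> takes care of \<open>(S, b)\<close>, and \<open>gap_vertex i\<close> for \<open>i \<in> S\<close> dominates all
  marks but \<open>4 + i\<close>.

  A homomorphism from the tensor product of the \<open>G\<^sub>S\<close>, \<open>S\<close> ranging over an antichain, to one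
  factor \<open>G\<^sub>S\<close> maps the constant tuples over a mark to that mark, for reasons of height.
  So it preserves the property of having an out-neighbour dominating \<open>(S, b)\<close>. For a tuple of top
  vertices this property only depends on the coordinate at \<open>S\<close>, and so the homomorphism acts
  on these tuples as a projection. Hence distinct tuples of top vertices stay distinct in the core,
  which therefore has at least \<open>2 ^ card I\<close> vertices. An antichain of size at least \<open>2 ^ k\<close> lives
  on \<open>2 * k\<close> points, and \<open>k\<close> can be taken linear in \<open>n\<close>, far beyond \<open>sqrt n\<close>.
\<close>

section \<open>Small orders and the growth estimate\<close>

lemma ex_family_trivial:
  assumes "n > 0"
  shows "\<exists>(I :: nat set) (G :: nat \<Rightarrow> nat pair_pre_digraph) C. finite I \<and> I \<noteq> {} \<and>
    (\<forall>i\<in>I. pair_digraph (G i) \<and> card (pverts (G i)) \<le> n) \<and> is_core C (tensor_product I G)"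
proof -
  let ?G = "\<lambda>i::nat. \<lparr> pverts = {0::nat}, parcs = {} \<rparr>"
  have G: "pair_digraph (?G i)" for i
    by unfold_locales auto
  obtain C where "is_core C (tensor_product {0} ?G)"
    using is_core_exists[OF pair_digraph_tensor_product[of "{0}" ?G]] G by blast
  then show ?thesis
    using G assms by (intro exI[of _ "{0}"] exI[of _ ?G] exI[of _ C]) auto
qed

text \<open>For large \<open>n\<close>, \<open>log 2 n \<le> sqrt n\<close> bounds the left side by
  \<open>2 powr (2 powr sqrt n)\<close>, and \<open>(n - 8) div 4\<close> is the largest
  \<open>k\<close> with \<open>4 * k + 8 \<le> n\<close>.\<close>

lemma eventually_powr_le_double_exp:
  "eventually (\<lambda>n. real n powr (2 powr sqrt (real n) / sqrt (real n)) \<le> 2 ^ 2 ^ ((n - 8) div 4))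
     sequentially"
proof -
  have "eventually (\<lambda>n. sqrt (real n) \<le> real n / 4 - 3) sequentially"
    by real_asymp
  moreover have "eventually (\<lambda>n. log 2 (real n) \<le> sqrt (real n)) sequentially"
    by real_asymp
  ultimately show ?thesis
    using eventually_ge_at_top[of 12]
  proof eventually_elim
    case (elim n)
    define k where "k = (n - 8) div 4"
    have "real n / 4 - 3 \<le> real k"
      using elim(3) unfolding k_def by linarith
    then have k: "sqrt (real n) \<le> real k"
      using elim(1) by simp
    have "real n powr (2 powr sqrt (real n) / sqrt (real n))
        = 2 powr (log 2 (real n) / sqrt (real n) * 2 powr sqrt (real n))"
      using elim(3) powr_powr[of 2 "log 2 (real n)"] by simp
    also have "\<dots> \<le> 2 powr (1 * 2 powr real k)"
      using k elim(2,3) by (intro powr_mono mult_mono) auto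
    also have "\<dots> = 2 ^ 2 ^ k"
      by (simp add: powr_realpow[symmetric])
    finally show ?case
      by (simp add: k_def)
  qed
qed

section \<open>The factor digraphs\<close>

definition top_vertex :: "nat \<Rightarrow> bool \<Rightarrow> nat" where
  "top_vertex m b = m + 4 + of_bool b"

definition mid_vertex :: "nat \<Rightarrow> bool \<Rightarrow> nat" where
  "mid_vertex m b = m + 6 + of_bool b"

definition gap_vertex :: "nat \<Rightarrow> nat \<Rightarrow> nat" where
  "gap_vertex m i = m + 8 + i"

definition pattern_digraph :: "nat \<Rightarrow> nat set \<Rightarrow> nat pair_pre_digraph" where
  "pattern_digraph m S =
     \<lparr> pverts = {..<2 * m + 8},
       parcs = {(l, Suc l) |l. l < m + 3} \<union>
         {(top_vertex m b, mid_vertex m b) |b. True} \<union>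
         {(top_vertex m b, gap_vertex m i) |b i. i \<in> S} \<union>
         {(mid_vertex m b, 2 + of_bool b) |b. True} \<union>
         {(mid_vertex m b, 4 + i) |b i. i \<in> S} \<union>
         {(gap_vertex m i, l) |i l. i \<in> S \<and> 2 \<le> l \<and> l < m + 4 \<and> l \<noteq> 4 + i} \<rparr>"

lemmas vertex_defs = top_vertex_def mid_vertex_def gap_vertex_def

text \<open>Marks start at \<open>2\<close> because the mid and gap vertices occupy level
  \<open>1\<close> and every arc has to ascend.\<close>

definition height :: "nat \<Rightarrow> nat \<Rightarrow> nat" where
  "height m v = (if v < m + 4 then v else if v < m + 6 then 0 else 1)"

lemma height_less: "height m v < m + 4"
  by (simp add: height_def)

lemma height_mono:
  assumes "S \<subseteq> {..<m}" "(u, v) \<in> parcs (pattern_digraph m S)"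
  shows "height m u < height m v"
  using assms by (auto simp: pattern_digraph_def height_def vertex_defs of_bool_def split: if_splits)

lemma pair_digraph_pattern_digraph:
  assumes "S \<subseteq> {..<m}"
  shows "pair_digraph (pattern_digraph m S)"
proof -
  let ?G = "pattern_digraph m S"
  have sub: "parcs ?G \<subseteq> pverts ?G \<times> pverts ?G"
    using assms by (auto simp: pattern_digraph_def vertex_defs)
  have "finite (pverts ?G)"
    by (simp add: pattern_digraph_def)
  moreover from this have "finite (parcs ?G)"
    using sub by (meson finite_SigmaI finite_subset)
  moreover have "u \<noteq> v" if "(u, v) \<in> parcs ?G" for u v
    using height_mono[OF assms that] by auto
  ultimately show ?thesis
    using sub by unfold_locales auto
qed

text \<open>The \<open>m + 4\<close> vertices of the walk have strictly increasing heights below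
  \<open>m + 4\<close>, so \<open>g l\<close> has height \<open>l\<close>; vertices off the spine
  only have heights \<open>0\<close> and \<open>1\<close>.\<close>

lemma walk_fixes_spine:
  assumes S: "S \<subseteq> {..<m}"
    and walk: "\<And>l. l < m + 3 \<Longrightarrow> (g l, g (Suc l)) \<in> parcs (pattern_digraph m S)"
    and l: "2 \<le> l" "l < m + 4"
  shows "g l = l"
proof -
  have step: "height m (g i) + (j - i) \<le> height m (g j)" if "i \<le> j" "j \<le> m + 3" for i j
    using that
  proof (induction j rule: dec_induct)
    case (step j)
    then show ?case
      using height_mono[OF S walk[of j]] by fastforce
  qed simp
  have "height m (g l) = l"
    using step[of 0 l] step[of l "m + 3"] height_less[of m "g (m + 3)"] l by linarith
  then show ?thesis
    using l by (auto simp: height_def split: if_splits)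
qed

text \<open>Spine vertices have at most one out-neighbour, too few as \<open>S\<close> is nonempty;
  \<open>gap_vertex m i\<close> misses \<open>4 + i\<close>, and the other mid vertex misses
  \<open>2 + of_bool b\<close>.\<close>

lemma dominator_of_own_pattern:
  assumes "S \<subseteq> {..<m}" "S \<noteq> {}" "(v, 2 + of_bool b) \<in> parcs (pattern_digraph m S)"
    and "\<And>i. i \<in> S \<Longrightarrow> (v, 4 + i) \<in> parcs (pattern_digraph m S)"
  shows "v = mid_vertex m b"
proof -
  obtain i where i: "i \<in> S" using assms(2) by blast
  have "v \<ge> m + 4"
    using assms(1,3) assms(4)[OF i] i
    by (auto simp: pattern_digraph_def vertex_defs of_bool_def split: if_splits)
  then have "v = mid_vertex m b \<or> (\<exists>i\<in>S. v = gap_vertex m i)"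
    using assms(1,3) by (cases b) (auto simp: pattern_digraph_def vertex_defs)
  moreover have "v \<noteq> gap_vertex m i" if "i \<in> S" for i
    using assms(1) assms(4)[OF that] that
    by (auto simp: pattern_digraph_def vertex_defs of_bool_def split: if_splits)
  ultimately show ?thesis by blast
qed

lemma in_neighbour_mid_vertex:
  assumes "S \<subseteq> {..<m}" "(u, mid_vertex m b) \<in> parcs (pattern_digraph m S)"
  shows "u = top_vertex m b"
  using assms by (auto simp: pattern_digraph_def vertex_defs of_bool_def split: if_splits)

section \<open>Homomorphisms from the tensor product\<close>

locale antichain_family =
  fixes I :: "'i set" and S :: "'i \<Rightarrow> nat set" and m :: nat
  assumes bounded: "i \<in> I \<Longrightarrow> S i \<subseteq> {..<m}"
    and nonempty: "i \<in> I \<Longrightarrow> S i \<noteq> {}"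
    and antichain: "\<lbrakk>i \<in> I; j \<in> I; i \<noteq> j\<rbrakk> \<Longrightarrow> \<not> S i \<subseteq> S j"
begin

abbreviation "P \<equiv> tensor_product I (\<lambda>i. pattern_digraph m (S i))"

lemma arc_P_iff:
  "(u, v) \<in> parcs P \<longleftrightarrow> u \<in> extensional I \<and> v \<in> extensional I \<and>
     (\<forall>i\<in>I. (u i, v i) \<in> parcs (pattern_digraph m (S i)))"
proof -
  have "x \<in> pverts (pattern_digraph m (S i)) \<and> y \<in> pverts (pattern_digraph m (S i))"
    if "i \<in> I" "(x, y) \<in> parcs (pattern_digraph m (S i))" for i x y
  proof -
    interpret pair_digraph "pattern_digraph m (S i)"
      using pair_digraph_pattern_digraph[OF bounded[OF that(1)]] .
    show ?thesis using that(2) by (auto dest: in_arcsD1 in_arcsD2)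
  qed
  then show ?thesis
    by (auto simp: tensor_product_def PiE_iff)
qed

lemma hom_to_factor_projects:
  assumes s: "s \<in> I" and f: "digraph_hom P (pattern_digraph m (S s)) f"
    and x: "x \<in> (\<Pi>\<^sub>E i\<in>I. range (top_vertex m))"
  shows "f x = x s"
proof -
  let ?G = "pattern_digraph m (S s)"
  define mark where "mark l = (\<lambda>i\<in>I. l)" for l :: nat
  have hom: "(f u, f v) \<in> parcs ?G" if "(u, v) \<in> parcs P" for u v
    using f that by (auto simp: digraph_hom_def)
  \<comment> \<open>The constant tuples over the spine form a walk in the product.\<close>
  have f_mark: "f (mark l) = l" if "2 \<le> l" "l < m + 4" for l
  proof (rule walk_fixes_spine[OF bounded[OF s] _ that, where g = "\<lambda>l. f (mark l)"])
    fix l assume "l < m + 3"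
    then have "(l, Suc l) \<in> parcs (pattern_digraph m T)" for T
      by (simp add: pattern_digraph_def)
    then have "(mark l, mark (Suc l)) \<in> parcs P"
      unfolding arc_P_iff by (simp add: mark_def)
    then show "(f (mark l), f (mark (Suc l))) \<in> parcs ?G"
      by (rule hom)
  qed
  obtain b where b: "x s = top_vertex m b"
    using PiE_mem[OF x s] by auto
  \<comment> \<open>The only mark missed by the gap vertex of \<open>e i\<close> lies outside the
    pattern \<open>(S s, b)\<close>.\<close>
  define e where "e i = (SOME e. e \<in> S i - S s)" for i
  have e: "e i \<in> S i - S s" if "i \<in> I" "i \<noteq> s" for i
  proof -
    have "\<exists>e. e \<in> S i - S s"
      using antichain[OF that(1) s that(2)] by blast
    then show ?thesis
      unfolding e_def by (rule someI_ex)
  qed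
  define y where "y = (\<lambda>i\<in>I. if i = s then mid_vertex m b else gap_vertex m (e i))"
  have "(x i, y i) \<in> parcs (pattern_digraph m (S i))" if i: "i \<in> I" for i
  proof (cases "i = s")
    case True
    with b i show ?thesis
      by (auto simp: y_def pattern_digraph_def)
  next
    case False
    moreover obtain c where "x i = top_vertex m c"
      using PiE_mem[OF x i] by auto
    ultimately show ?thesis
      using e[OF i False] i by (auto simp: y_def pattern_digraph_def)
  qed
  then have "(x, y) \<in> parcs P"
    unfolding arc_P_iff using x by (auto simp: PiE_iff y_def)
  then have fxy: "(f x, f y) \<in> parcs ?G"
    by (rule hom)
  have "(f y, l) \<in> parcs ?G" if l: "l = 2 + of_bool b \<or> (\<exists>j\<in>S s. l = 4 + j)" for l
  proof -
    have lb: "2 \<le> l" "l < m + 4"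
      using l bounded[OF s] by auto
    have "(y i, mark l i) \<in> parcs (pattern_digraph m (S i))" if i: "i \<in> I" for i
    proof (cases "i = s")
      case True
      have "(mid_vertex m b, l) \<in> parcs ?G"
        using l unfolding pattern_digraph_def by (elim disjE) auto
      with True i show ?thesis
        by (simp add: y_def mark_def)
    next
      case False
      then have "l \<noteq> 4 + e i"
        using l e[OF i False] by (cases b) auto
      then have "(gap_vertex m (e i), l) \<in> parcs (pattern_digraph m (S i))"
        using lb e[OF i False] unfolding pattern_digraph_def by auto
      with False i show ?thesis
        by (simp add: y_def mark_def)
    qed
    then have "(y, mark l) \<in> parcs P"
      unfolding arc_P_iff by (simp add: y_def mark_def)
    from hom[OF this] show ?thesis
      by (simp add: f_mark[OF lb])
  qed
  then have "f y = mid_vertex m b"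
    by (intro dominator_of_own_pattern[OF bounded[OF s] nonempty[OF s]]) auto
  with fxy have "f x = top_vertex m b"
    using in_neighbour_mid_vertex[OF bounded[OF s]] by metis
  with b show ?thesis by simp
qed

text \<open>Each coordinate of \<open>f \<circ> g\<close> is a homomorphism to a factor, so
  \<open>f \<circ> g\<close> fixes all tuples of top vertices and \<open>g\<close> separates
  them.\<close>

lemma card_core_ge:
  assumes "finite I" "is_core C P"
  shows "2 ^ card I \<le> card (pverts C)"
proof -
  let ?X = "\<Pi>\<^sub>E i\<in>I. range (top_vertex m)"
  obtain f g where f: "digraph_hom C P f" and g: "digraph_hom P C g"
    using assms(2) by (auto simp: is_core_def hom_equivalent_def)
  have proj: "f (g x) s = x s" if "s \<in> I" "x \<in> ?X" for s x
  proof (rule hom_to_factor_projects[OF that(1) _ that(2), where f = "\<lambda>x. f (g x) s"])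
    have "f (g v) \<in> pverts P" if "v \<in> pverts P" for v
      using f g that unfolding digraph_hom_def by blast
    moreover have "w s \<in> pverts (pattern_digraph m (S s))" if "w \<in> pverts P" for w
      using that \<open>s \<in> I\<close> by (auto simp: tensor_product_def)
    moreover have "(f (g u), f (g v)) \<in> parcs P" if "(u, v) \<in> parcs P" for u v
      using f g that unfolding digraph_hom_def by blast
    ultimately show "digraph_hom P (pattern_digraph m (S s)) (\<lambda>x. f (g x) s)"
      unfolding digraph_hom_def using \<open>s \<in> I\<close> arc_P_iff by blast
  qed
  have "inj_on g ?X"
  proof (rule inj_onI)
    fix x x' assume x: "x \<in> ?X" "x' \<in> ?X" "g x = g x'"
    show "x = x'"
      using x(1,2) by (rule PiE_ext) (metis proj x)
  qed
  moreover have "range (top_vertex m) \<subseteq> pverts (pattern_digraph m T)" for T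
    by (auto simp: pattern_digraph_def top_vertex_def of_bool_def)
  then have "?X \<subseteq> pverts P"
    unfolding tensor_product_def by (simp add: PiE_mono)
  then have "g ` ?X \<subseteq> pverts C"
    using g by (auto simp: digraph_hom_def)
  moreover have "finite (pverts C)"
    using assms(2) by (auto simp: is_core_def pair_digraph_def pair_fin_digraph_def
        pair_fin_digraph_axioms_def)
  ultimately have "card ?X \<le> card (pverts C)"
    by (metis card_image card_mono)
  moreover have "card (range (top_vertex m)) = 2"
    by (simp add: UNIV_bool top_vertex_def)
  ultimately show ?thesis
    using assms(1) by (simp add: card_PiE)
qed

end

section \<open>The middle layer as index set, and the asymptotic bound\<close>

lemma ex_family_with_large_core:
  assumes "n \<ge> 12"
  shows "\<exists>(I :: nat set) (G :: nat \<Rightarrow> nat pair_pre_digraph) C. finite I \<and> I \<noteq> {} \<and>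
    (\<forall>i\<in>I. pair_digraph (G i) \<and> card (pverts (G i)) \<le> n) \<and>
    is_core C (tensor_product I G) \<and> 2 ^ 2 ^ ((n - 8) div 4) \<le> card (pverts C)"
proof -
  define k where "k = (n - 8) div 4"
  have k: "k > 0" "4 * k + 8 \<le> n"
    using assms by (auto simp: k_def)
  define F where "F = {S. S \<subseteq> {..<2 * k} \<and> card S = k}"
  \<comment> \<open>Sets are encoded because the indices must be natural numbers.\<close>
  define I where "I = set_encode ` F"
  have fin: "finite S" if "S \<in> F" for S
    using that by (auto simp: F_def intro: finite_subset)
  have "inj_on set_encode F"
    using inj_on_set_encode by (rule inj_on_subset) (auto dest: fin)
  then have "card I = (2 * k) choose k"
    by (simp add: I_def card_image F_def n_subsets)
  moreover have "2 ^ k \<le> real ((2 * k) choose k)"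
    using binomial_ge_n_over_k_pow_k[of k "2 * k", where ?'a = real] k by simp
  ultimately have card_I: "2 ^ k \<le> card I"
    by (metis of_nat_le_iff of_nat_numeral of_nat_power)
  \<comment> \<open>Positivity also gives finiteness, as infinite sets have \<open>card\<close>
    zero.\<close>
  then have "0 < card I"
    using less_le_trans[of 0 "2 ^ k" "card I"] by simp
  then have I: "finite I" "I \<noteq> {}"
    by (simp_all add: card_gt_0_iff)
  have dec: "set_decode i \<in> F" if "i \<in> I" for i
    using that by (auto simp: I_def fin)
  interpret antichain_family I set_decode "2 * k"
  proof
    fix i j assume ij: "i \<in> I" "j \<in> I" "i \<noteq> j"
    show "\<not> set_decode i \<subseteq> set_decode j"
    proof
      assume "set_decode i \<subseteq> set_decode j"
      then have "set_decode i = set_decode j"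
        using dec[OF ij(1)] dec[OF ij(2)] by (intro card_subset_eq) (auto simp: F_def)
      then show False
        using ij(3) by (metis set_decode_inverse)
    qed
  next
    fix i assume i: "i \<in> I"
    show "set_decode i \<subseteq> {..<2 * k}" "set_decode i \<noteq> {}"
      using dec[OF i] k by (auto simp: F_def)
  qed
  have dig: "pair_digraph (pattern_digraph (2 * k) (set_decode i))" if "i \<in> I" for i
    by (rule pair_digraph_pattern_digraph[OF bounded[OF that]])
  then have "pair_digraph P"
    by (rule pair_digraph_tensor_product[OF I])
  then obtain C where C: "is_core C P"
    using is_core_exists by blast
  have "(2::nat) ^ 2 ^ k \<le> 2 ^ card I"
    using card_I by (intro power_increasing) auto
  also have "\<dots> \<le> card (pverts C)"
    by (rule card_core_ge[OF I(1) C])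
  finally show ?thesis
    using I C dig k
    by (intro exI[of _ I] exI[of _ "\<lambda>i. pattern_digraph (2 * k) (set_decode i)"] exI[of _ C])
      (auto simp: k_def pattern_digraph_def)
qed

theorem proposition43:
  shows "\<exists>(I :: nat \<Rightarrow> nat set) (G :: nat \<Rightarrow> nat \<Rightarrow> nat pair_pre_digraph)
            (C :: nat \<Rightarrow> nat pair_pre_digraph).
     (\<forall>n>0. finite (I n) \<and> I n \<noteq> {} \<and>
        (\<forall>i\<in>I n. pair_digraph (G n i) \<and> card (pverts (G n i)) \<le> n) \<and>
        is_core (C n) (tensor_product (I n) (G n))) \<and>
     (\<lambda>n. real (card (pverts (C n)))) \<in> \<Omega>(\<lambda>n. real n powr (2 powr sqrt (real n) / sqrt (real n)))"
proof -
  \<comment> \<open>Below \<open>12\<close> any family will do, since the bound is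
    asymptotic.\<close>
  have "\<forall>n. \<exists>(I :: nat set) (G :: nat \<Rightarrow> nat pair_pre_digraph) C. n > 0 \<longrightarrow>
    (finite I \<and> I \<noteq> {} \<and> (\<forall>i\<in>I. pair_digraph (G i) \<and> card (pverts (G i)) \<le> n) \<and>
     is_core C (tensor_product I G)) \<and>
    (n \<ge> 12 \<longrightarrow> 2 ^ 2 ^ ((n - 8) div 4) \<le> card (pverts C))"
    using ex_family_with_large_core ex_family_trivial by (metis (no_types, lifting))
  then obtain I :: "nat \<Rightarrow> nat set" and G :: "nat \<Rightarrow> nat \<Rightarrow> nat pair_pre_digraph" and C where
    *: "n > 0 \<longrightarrow> (finite (I n) \<and> I n \<noteq> {} \<and>
        (\<forall>i\<in>I n. pair_digraph (G n i) \<and> card (pverts (G n i)) \<le> n) \<and>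
        is_core (C n) (tensor_product (I n) (G n))) \<and>
      (n \<ge> 12 \<longrightarrow> 2 ^ 2 ^ ((n - 8) div 4) \<le> card (pverts (C n)))" for n
    by metis
  have "eventually (\<lambda>n. real n powr (2 powr sqrt (real n) / sqrt (real n))
      \<le> real (card (pverts (C n)))) sequentially"
    using eventually_powr_le_double_exp eventually_ge_at_top[of 12]
  proof eventually_elim
    case (elim n)
    have "2 ^ 2 ^ ((n - 8) div 4) \<le> real (card (pverts (C n)))"
      using *[of n] elim(2) by (metis less_le_trans of_nat_le_iff of_nat_numeral of_nat_power
          zero_less_numeral)
    with elim(1) show ?case by linarith
  qed
  then have "(\<lambda>n. real (card (pverts (C n))))
      \<in> \<Omega>(\<lambda>n. real n powr (2 powr sqrt (real n) / sqrt (real n)))"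
    by (intro landau_omega.bigI[of 1]) auto
  with * show ?thesis
    by blast
qed

end
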